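(* Let $p^\star\in\mathbb{R}$, let $\varepsilon>0$ be small enough, and let $(p^\star-\varepsilon,p^\star+\varepsilon)\ni p\mapsto n_p\in\mathcal{N}$ be a continuously differentiable parametrization of the refractive index. Let $$(p^\star-\varepsilon,p^\star+\varepsilon)\ni p\mapsto(\kappa_p,(v_p,w_p))\in\mathbb{C}_{\neq0}\times\mathcal{V}_{\neq0}$$ be an eigenpair trajectory of the weak ITP that is continuous on $(p^\star-\varepsilon,p^\star+\varepsilon)$ and continuously differentiable on $(p^\star-\varepsilon,p^\star+\varepsilon)\setminus\{p^\star\}$ (both in $\mathbb{C}\times[H^1(D;\mathbb{C})]^2$). Assume that $\int_D n_{p^\star}'|w_{p^\star}|^2\neq0$, where $n_{p^\star}'\in L^\infty(D)$ is the derivative of $p\mapsto n_p$ at $p=p^\star$. Assume moreover that $\kappa_p\in\mathbb{C}\setminus\mathbb{R}$ for all $p\in(p^\star-\varepsilon,p^\star)$ (respectively, for all $p\in(p^\star,p^\star+\varepsilon)$), but $\kappa_{p^\star}\in\mathbb{R}\setminus\{0\}$. Then $p^\star$ is an exceptional point of the eigenpair trajectory: the eigenpair trajectory is non-differentiable at $p^\star$.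
   Context: $D\subset\mathbb{R}^d$, $d\in\{1,2,3\}$, is a bounded Lipschitz domain. $\mathbb{C}_{\neq0}:=\mathbb{C}\setminus\{0\}$. The set of admissible (real-valued) refractive indices is $\mathcal{N}:=\{n\in L^\infty(D):\operatorname{ess\,inf}n>0\}\setminus\{1\}$. Let $\mathcal{V}=\{(\phi,\psi)\in[H^1(D;\mathbb{C})]^2:\phi-\psi=0\text{ on }\partial D\}$ and $\mathcal{V}_{\neq0}=\mathcal{V}\setminus\{(0,0)\}$. Weak interior transmission eigenvalue problem (weak ITP) with refractive index $n\in\mathcal{N}$: an eigenpair is $(\kappa,(v,w))\in\mathbb{C}_{\neq0}\times\mathcal{V}_{\neq0}$ such that $$\int_D(\nabla v\cdot\nabla\overline{\phi}-\nabla w\cdot\nabla\overline{\psi})=\kappa^2\int_D(v\overline{\phi}-nw\overline{\psi})\quad\text{for all }(\phi,\psi)\in\mathcal{V}.$$ For a parametrized refractive index $p\mapsto n_p\in\mathcal{N}$ ($p$ a real scalar), an eigenpair trajectory is a map $p\mapsto(\kappa_p,(v_p,w_p))$ such that, for each $p$, $(\kappa_p,(v_p,w_p))$ is an eigenpair of the weak ITP with refractive index $n_p$. Smoothness of $p\mapsto n_p$ is understood in $L^\infty(D)$. An exceptional point of a continuous eigenpair trajectory is any value of $p$ where the trajectory is not continuously differentiable with respect to $p$. *)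

theory Defs
  imports "HOL-Analysis.Analysis" "HOL-Probability.Essential_Supremum"
begin

text \<open>
  Elements of \<open>L\<^sup>2(D)\<close>, \<open>H\<^sup>1(D)\<close> and \<open>L\<^sup>\<infinity>(D)\<close> are represented by functions on the whole space,
  of which only the restriction to \<open>D\<close>, up to Lebesgue null sets, is relevant. Equality in these
  spaces is therefore almost-everywhere equality with respect to \<^term>\<open>lebesgue_on D\<close>, and their
  norms are seminorms on the representatives.
\<close>

subsection \<open>Lipschitz domains\<close>

text \<open>
  Locally, \<open>D\<close> lies strictly above the graph of a Lipschitz function over the hyperplane orthogonal
  to a unit vector \<open>u\<close>; the boundary is then locally the graph itself. In dimension one the
  hyperplane is \<open>{0}\<close>, and bounded Lipschitz domains are the bounded open intervals.
\<close>

definition bounded_lipschitz_domain :: "(real^'d) set \<Rightarrow> bool" where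
  "bounded_lipschitz_domain D \<longleftrightarrow>
     open D \<and> connected D \<and> D \<noteq> {} \<and> bounded D \<and>
     (\<forall>x\<in>frontier D. \<exists>U u g L. open U \<and> x \<in> U \<and> norm u = 1 \<and>
        lipschitz_on L {z. z \<bullet> u = 0} g \<and>
        D \<inter> U = {y\<in>U. y \<bullet> u > g (y - (y \<bullet> u) *\<^sub>R u)})"

subsection \<open>Essentially bounded functions\<close>

definition essinf :: "'a measure \<Rightarrow> ('a \<Rightarrow> ereal) \<Rightarrow> ereal" where
  "essinf M f = - esssup M (\<lambda>x. - f x)"

definition Linf :: "(real^'d) set \<Rightarrow> (real^'d \<Rightarrow> real) set" where
  "Linf D = {f \<in> borel_measurable (lebesgue_on D).
     esssup (lebesgue_on D) (\<lambda>x. ereal \<bar>f x\<bar>) < \<infinity>}"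

definition Linf_norm :: "(real^'d) set \<Rightarrow> (real^'d \<Rightarrow> real) \<Rightarrow> real" where
  "Linf_norm D f = real_of_ereal (esssup (lebesgue_on D) (\<lambda>x. ereal \<bar>f x\<bar>))"

definition refractive_indices :: "(real^'d) set \<Rightarrow> (real^'d \<Rightarrow> real) set" where
  "refractive_indices D = {n \<in> Linf D.
     essinf (lebesgue_on D) (\<lambda>x. ereal (n x)) > 0 \<and> \<not> (AE x in lebesgue_on D. n x = 1)}"

subsection \<open>Sobolev spaces\<close>

definition L2 :: "(real^'d) set \<Rightarrow> (real^'d \<Rightarrow> complex) set" where
  "L2 D = {u \<in> borel_measurable (lebesgue_on D). integrable (lebesgue_on D) (\<lambda>x. (cmod (u x))\<^sup>2)}"

definition partial :: "'d \<Rightarrow> (real^'d \<Rightarrow> complex) \<Rightarrow> real^'d \<Rightarrow> complex" where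
  "partial i f x = frechet_derivative f (at x) (axis i 1)"

primrec Ck :: "nat \<Rightarrow> (real^'d \<Rightarrow> complex) \<Rightarrow> bool" where
  "Ck 0 f \<longleftrightarrow> continuous_on UNIV f"
| "Ck (Suc k) f \<longleftrightarrow> (\<forall>x. f differentiable (at x)) \<and> (\<forall>i. Ck k (partial i f))"

definition test_functions :: "(real^'d) set \<Rightarrow> (real^'d \<Rightarrow> complex) set" where
  "test_functions D = {f. (\<forall>k. Ck k f) \<and> compact (closure {x. f x \<noteq> 0}) \<and> closure {x. f x \<noteq> 0} \<subseteq> D}"

definition has_weak_gradient ::
    "(real^'d) set \<Rightarrow> (real^'d \<Rightarrow> complex) \<Rightarrow> (real^'d \<Rightarrow> complex^'d) \<Rightarrow> bool" where
  "has_weak_gradient D u g \<longleftrightarrow>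
     (\<forall>i. (\<lambda>x. g x $ i) \<in> L2 D \<and>
        (\<forall>f\<in>test_functions D.
           (LINT x|lebesgue_on D. u x * partial i f x) = - (LINT x|lebesgue_on D. g x $ i * f x)))"

definition H1 :: "(real^'d) set \<Rightarrow> (real^'d \<Rightarrow> complex) set" where
  "H1 D = {u \<in> L2 D. \<exists>g. has_weak_gradient D u g}"

text \<open>The weak gradient is determined almost everywhere in \<open>D\<close>; a representative is chosen.\<close>

definition weak_grad :: "(real^'d) set \<Rightarrow> (real^'d \<Rightarrow> complex) \<Rightarrow> real^'d \<Rightarrow> complex^'d" where
  "weak_grad D u = (SOME g. has_weak_gradient D u g)"

definition H1_norm :: "(real^'d) set \<Rightarrow> (real^'d \<Rightarrow> complex) \<Rightarrow> real" where
  "H1_norm D u = sqrt ((LINT x|lebesgue_on D. (cmod (u x))\<^sup>2) +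
     (LINT x|lebesgue_on D. (norm (weak_grad D u x))\<^sup>2))"

text \<open>
  Vanishing on \<open>\<partial>D\<close> for elements of \<open>H\<^sup>1(D)\<close> is membership in \<open>H\<^sup>1\<^sub>0(D)\<close>, the closure of the test
  functions; on a bounded Lipschitz domain this is the kernel of the boundary trace.
\<close>

definition H10 :: "(real^'d) set \<Rightarrow> (real^'d \<Rightarrow> complex) set" where
  "H10 D = {u \<in> H1 D. \<forall>e>0. \<exists>f\<in>test_functions D. H1_norm D (\<lambda>x. u x - f x) < e}"

definition itp_space :: "(real^'d) set \<Rightarrow> ((real^'d \<Rightarrow> complex) \<times> (real^'d \<Rightarrow> complex)) set" where
  "itp_space D = {(\<phi>, \<psi>). \<phi> \<in> H1 D \<and> \<psi> \<in> H1 D \<and> (\<lambda>x. \<phi> x - \<psi> x) \<in> H10 D}"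

definition itp_space_nz :: "(real^'d) set \<Rightarrow> ((real^'d \<Rightarrow> complex) \<times> (real^'d \<Rightarrow> complex)) set" where
  "itp_space_nz D = {(\<phi>, \<psi>) \<in> itp_space D.
     \<not> ((AE x in lebesgue_on D. \<phi> x = 0) \<and> (AE x in lebesgue_on D. \<psi> x = 0))}"

subsection \<open>The weak interior transmission eigenvalue problem\<close>

definition cdot_cnj :: "complex^'d \<Rightarrow> complex^'d \<Rightarrow> complex" where
  "cdot_cnj a b = (\<Sum>i\<in>UNIV. a $ i * cnj (b $ i))"

definition itp_eigenpair ::
    "(real^'d) set \<Rightarrow> (real^'d \<Rightarrow> real) \<Rightarrow> complex \<Rightarrow> (real^'d \<Rightarrow> complex) \<Rightarrow> (real^'d \<Rightarrow> complex) \<Rightarrow> bool"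
  where
  "itp_eigenpair D n \<kappa> v w \<longleftrightarrow> \<kappa> \<noteq> 0 \<and> (v, w) \<in> itp_space_nz D \<and>
     (\<forall>(\<phi>, \<psi>)\<in>itp_space D.
        (LINT x|lebesgue_on D. cdot_cnj (weak_grad D v x) (weak_grad D \<phi> x)
                             - cdot_cnj (weak_grad D w x) (weak_grad D \<psi> x))
        = \<kappa>\<^sup>2 * (LINT x|lebesgue_on D. v x * cnj (\<phi> x) - of_real (n x) * w x * cnj (\<psi> x)))"

subsection \<open>Calculus in a space of functions with a given norm\<close>

text \<open>
  Continuity and differentiability of curves \<open>p \<mapsto> f p\<close> with values in a function space \<open>X\<close> with
  norm \<open>N\<close>; here \<open>(X, N)\<close> is \<open>(L\<^sup>\<infinity>(D), Linf_norm D)\<close> or \<open>(H\<^sup>1(D), H1_norm D)\<close>. The library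
  notions do not apply, since \<open>N\<close> depends on \<open>D\<close> and is only a seminorm on representatives.
\<close>

definition curve_continuous_on ::
    "(('a \<Rightarrow> 'b::real_normed_vector) \<Rightarrow> real) \<Rightarrow> real set \<Rightarrow> (real \<Rightarrow> 'a \<Rightarrow> 'b) \<Rightarrow> bool" where
  "curve_continuous_on N S f \<longleftrightarrow>
     (\<forall>p\<in>S. ((\<lambda>q. N (\<lambda>x. f q x - f p x)) \<longlongrightarrow> 0) (at p within S))"

definition curve_has_derivative ::
    "('a \<Rightarrow> 'b::real_normed_vector) set \<Rightarrow> (('a \<Rightarrow> 'b) \<Rightarrow> real) \<Rightarrow>
     (real \<Rightarrow> 'a \<Rightarrow> 'b) \<Rightarrow> ('a \<Rightarrow> 'b) \<Rightarrow> real \<Rightarrow> bool" where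
  "curve_has_derivative X N f f' p \<longleftrightarrow> f' \<in> X \<and>
     ((\<lambda>q. N (\<lambda>x. (f q x - f p x) /\<^sub>R (q - p) - f' x)) \<longlongrightarrow> 0) (at p)"

definition curve_C1_on ::
    "('a \<Rightarrow> 'b::real_normed_vector) set \<Rightarrow> (('a \<Rightarrow> 'b) \<Rightarrow> real) \<Rightarrow> real set \<Rightarrow>
     (real \<Rightarrow> 'a \<Rightarrow> 'b) \<Rightarrow> (real \<Rightarrow> 'a \<Rightarrow> 'b) \<Rightarrow> bool" where
  "curve_C1_on X N S f f' \<longleftrightarrow>
     (\<forall>p\<in>S. curve_has_derivative X N f (f' p) p) \<and> curve_continuous_on N S f'"

subsection \<open>Eigenpair trajectories and exceptional points\<close>

definition eigenpair_trajectory ::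
    "(real^'d) set \<Rightarrow> real set \<Rightarrow> (real \<Rightarrow> real^'d \<Rightarrow> real) \<Rightarrow> (real \<Rightarrow> complex) \<Rightarrow>
     (real \<Rightarrow> real^'d \<Rightarrow> complex) \<Rightarrow> (real \<Rightarrow> real^'d \<Rightarrow> complex) \<Rightarrow> bool" where
  "eigenpair_trajectory D S n \<kappa> v w \<longleftrightarrow> (\<forall>p\<in>S. itp_eigenpair D (n p) (\<kappa> p) (v p) (w p))"

definition trajectory_continuous_on ::
    "(real^'d) set \<Rightarrow> real set \<Rightarrow> (real \<Rightarrow> complex) \<Rightarrow>
     (real \<Rightarrow> real^'d \<Rightarrow> complex) \<Rightarrow> (real \<Rightarrow> real^'d \<Rightarrow> complex) \<Rightarrow> bool" where
  "trajectory_continuous_on D S \<kappa> v w \<longleftrightarrow> continuous_on S \<kappa> \<and>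
     curve_continuous_on (H1_norm D) S v \<and> curve_continuous_on (H1_norm D) S w"

definition trajectory_differentiable_at ::
    "(real^'d) set \<Rightarrow> real \<Rightarrow> (real \<Rightarrow> complex) \<Rightarrow>
     (real \<Rightarrow> real^'d \<Rightarrow> complex) \<Rightarrow> (real \<Rightarrow> real^'d \<Rightarrow> complex) \<Rightarrow> bool" where
  "trajectory_differentiable_at D p \<kappa> v w \<longleftrightarrow> \<kappa> differentiable (at p) \<and>
     (\<exists>v'. curve_has_derivative (H1 D) (H1_norm D) v v' p) \<and>
     (\<exists>w'. curve_has_derivative (H1 D) (H1_norm D) w w' p)"

definition trajectory_C1_on ::
    "(real^'d) set \<Rightarrow> real set \<Rightarrow> (real \<Rightarrow> complex) \<Rightarrow>
     (real \<Rightarrow> real^'d \<Rightarrow> complex) \<Rightarrow> (real \<Rightarrow> real^'d \<Rightarrow> complex) \<Rightarrow> bool" where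
  "trajectory_C1_on D S \<kappa> v w \<longleftrightarrow> \<kappa> C1_differentiable_on S \<and>
     (\<exists>v'. curve_C1_on (H1 D) (H1_norm D) S v v') \<and>
     (\<exists>w'. curve_C1_on (H1 D) (H1_norm D) S w w')"

definition exceptional_point ::
    "(real^'d) set \<Rightarrow> real set \<Rightarrow> (real \<Rightarrow> complex) \<Rightarrow>
     (real \<Rightarrow> real^'d \<Rightarrow> complex) \<Rightarrow> (real \<Rightarrow> real^'d \<Rightarrow> complex) \<Rightarrow> real \<Rightarrow> bool" where
  "exceptional_point D S \<kappa> v w p \<longleftrightarrow> p \<in> S \<and>
     \<not> (\<exists>\<delta>>0. {p - \<delta><..<p + \<delta>} \<subseteq> S \<and> trajectory_C1_on D {p - \<delta><..<p + \<delta>} \<kappa> v w)"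

end

theory Submission
  imports Defs
begin

text \<open>
  Testing the weak problem at \<open>p\<close> with its own eigenfunctions shows that
  \<open>\<integral> \<bar>v\<^sub>p\<bar>\<^sup>2 - n\<^sub>p \<bar>w\<^sub>p\<bar>\<^sup>2 = 0\<close> whenever \<open>\<kappa>\<^sub>p\<^sup>2\<close> is not real, hence by continuity also at \<open>p\<^sub>0\<close>. Testing
  it at \<open>p\<close> with the eigenfunctions at \<open>p\<^sub>0\<close> and vice versa gives, as \<open>\<kappa>\<close> is real at \<open>p\<^sub>0\<close> and the
  gradient form is Hermitian,
  \<open>(\<kappa>\<^sub>p\<^sup>2 - \<kappa>\<^sub>0\<^sup>2) \<integral> (v\<^sub>p cnj v\<^sub>0 - n\<^sub>p w\<^sub>p cnj w\<^sub>0) = \<kappa>\<^sub>0\<^sup>2 \<integral> (n\<^sub>p - n\<^sub>0) w\<^sub>p cnj w\<^sub>0\<close>. If \<open>\<kappa>\<close> were differentiable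
  at \<open>p\<^sub>0\<close>, dividing by \<open>p - p\<^sub>0\<close> and letting \<open>p \<rightarrow> p\<^sub>0\<close> would yield \<open>0 = \<kappa>\<^sub>0\<^sup>2 \<integral> n'\<^sub>0 \<bar>w\<^sub>0\<bar>\<^sup>2\<close>.
\<close>

section \<open>Essentially bounded functions\<close>

lemma Linf_iff_bounded:
  "f \<in> Linf D \<longleftrightarrow> f \<in> borel_measurable (lebesgue_on D) \<and> (\<exists>c. AE x in lebesgue_on D. \<bar>f x\<bar> \<le> c)"
proof (intro iffI conjI; (elim conjE exE)?)
  let ?s = "esssup (lebesgue_on D) (\<lambda>x. ereal \<bar>f x\<bar>)"
  assume f: "f \<in> Linf D"
  then show "f \<in> borel_measurable (lebesgue_on D)"
    by (simp add: Linf_def)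
  from f have fin: "?s < \<infinity>"
    by (simp add: Linf_def)
  have "AE x in lebesgue_on D. ereal \<bar>f x\<bar> \<le> ?s"
    by (rule esssup_AE)
  then have "AE x in lebesgue_on D. \<bar>f x\<bar> \<le> real_of_ereal ?s"
    \<comment> \<open>Besides a real value, \<open>?s\<close> may still be
      \<open>-\<infinity>\<close>; the almost-everywhere bound is then false at every point, so the
      measure is null and any bound holds.\<close>
    using fin by (cases ?s) auto
  then show "\<exists>c. AE x in lebesgue_on D. \<bar>f x\<bar> \<le> c" ..
next
  fix c assume f: "f \<in> borel_measurable (lebesgue_on D)" and c: "AE x in lebesgue_on D. \<bar>f x\<bar> \<le> c"
  have "esssup (lebesgue_on D) (\<lambda>x. ereal \<bar>f x\<bar>) \<le> ereal c"
    using f c by (intro esssup_I) auto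
  then show "f \<in> Linf D"
    using f by (auto simp: Linf_def)
qed

lemma Linf_measurable: "f \<in> Linf D \<Longrightarrow> f \<in> borel_measurable (lebesgue_on D)"
  by (simp add: Linf_iff_bounded)

lemma AE_le_Linf_norm:
  assumes "f \<in> Linf D"
  shows "AE x in lebesgue_on D. \<bar>f x\<bar> \<le> Linf_norm D f"
proof -
  let ?s = "esssup (lebesgue_on D) (\<lambda>x. ereal \<bar>f x\<bar>)"
  have "AE x in lebesgue_on D. ereal \<bar>f x\<bar> \<le> ?s"
    by (rule esssup_AE)
  then show ?thesis
    using assms unfolding Linf_norm_def Linf_def by (cases ?s) auto
qed

lemma Linf_diff:
  assumes "f \<in> Linf D" "g \<in> Linf D"
  shows "(\<lambda>x. f x - g x) \<in> Linf D"
proof -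
  from assms obtain a b where ab: "AE x in lebesgue_on D. \<bar>f x\<bar> \<le> a" "AE x in lebesgue_on D. \<bar>g x\<bar> \<le> b"
    and [measurable]: "f \<in> borel_measurable (lebesgue_on D)" "g \<in> borel_measurable (lebesgue_on D)"
    by (auto simp: Linf_iff_bounded)
  from ab have "AE x in lebesgue_on D. \<bar>f x - g x\<bar> \<le> a + b"
    by eventually_elim simp
  then show ?thesis
    by (auto simp: Linf_iff_bounded)
qed

lemma Linf_scaleR:
  assumes "f \<in> Linf D"
  shows "(\<lambda>x. c *\<^sub>R f x) \<in> Linf D"
proof -
  from assms obtain a where a: "AE x in lebesgue_on D. \<bar>f x\<bar> \<le> a"
    and [measurable]: "f \<in> borel_measurable (lebesgue_on D)"
    by (auto simp: Linf_iff_bounded)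
  from a have "AE x in lebesgue_on D. \<bar>c *\<^sub>R f x\<bar> \<le> \<bar>c\<bar> * a"
    by eventually_elim (simp add: abs_mult mult_left_mono)
  then show ?thesis
    by (auto simp: Linf_iff_bounded)
qed

lemma Linf_const: "(\<lambda>x. c) \<in> Linf D"
  by (auto simp: Linf_iff_bounded)

text \<open>On a null domain the essential supremum of 0 is \<open>-\<infinity>\<close>, not 0;
  \<open>real_of_ereal\<close> sends it to 0, so both cases agree.\<close>

lemma Linf_norm_zero: "Linf_norm D (\<lambda>x. 0) = 0"
proof (cases "emeasure (lebesgue_on D) (space (lebesgue_on D)) = 0")
  case True
  then have "esssup (lebesgue_on D) (\<lambda>x. 0 :: ereal) = - \<infinity>"
    by (simp add: esssup_def ae_filter_eq_bot_iff[THEN iffD2] bot_ereal_def)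
  then show ?thesis
    by (simp add: Linf_norm_def zero_ereal_def)
next
  case False
  then show ?thesis
    by (simp add: Linf_norm_def esssup_const)
qed

section \<open>The L2 seminorm: Cauchy-Schwarz and triangle inequalities\<close>

definition L2_norm :: "(real^'d) set \<Rightarrow> (real^'d \<Rightarrow> complex) \<Rightarrow> real" where
  "L2_norm D u = sqrt (LINT x|lebesgue_on D. (cmod (u x))\<^sup>2)"

lemma L2_norm_nonneg: "0 \<le> L2_norm D u"
  by (simp add: L2_norm_def)

lemma L2_norm_squared: "(L2_norm D u)\<^sup>2 = (LINT x|lebesgue_on D. (cmod (u x))\<^sup>2)"
  by (simp add: L2_norm_def)

text \<open>The gradient part of \<open>H1_norm\<close> is nonnegative. Through this bound,
  continuity of the trajectory yields convergence of the mass integrals, the only integrals taken to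
  a limit.\<close>

lemma L2_norm_le_H1_norm: "L2_norm D u \<le> H1_norm D u"
  by (simp add: L2_norm_def H1_norm_def)

lemma L2_measurable: "u \<in> L2 D \<Longrightarrow> u \<in> borel_measurable (lebesgue_on D)"
  by (simp add: L2_def)

lemma H1_imp_L2: "u \<in> H1 D \<Longrightarrow> u \<in> L2 D"
  by (simp add: H1_def)

lemma integrable_cmod_mult:
  assumes "g \<in> L2 D" "h \<in> L2 D"
  shows "integrable (lebesgue_on D) (\<lambda>x. cmod (g x) * cmod (h x))"
proof (rule Bochner_Integration.integrable_bound)
  show "integrable (lebesgue_on D) (\<lambda>x. (cmod (g x))\<^sup>2 + (cmod (h x))\<^sup>2)"
    using assms by (auto simp: L2_def)
  show "(\<lambda>x. cmod (g x) * cmod (h x)) \<in> borel_measurable (lebesgue_on D)"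
    using assms[THEN L2_measurable] by measurable
  show "AE x in lebesgue_on D. norm (cmod (g x) * cmod (h x)) \<le> norm ((cmod (g x))\<^sup>2 + (cmod (h x))\<^sup>2)"
  proof (rule AE_I2)
    fix x
    have "0 \<le> (cmod (g x) - cmod (h x))\<^sup>2"
      by simp
    moreover have "0 \<le> cmod (g x) * cmod (h x)"
      by simp
    ultimately show "norm (cmod (g x) * cmod (h x)) \<le> norm ((cmod (g x))\<^sup>2 + (cmod (h x))\<^sup>2)"
      unfolding power2_diff real_norm_def by linarith
  qed
qed

text \<open>Transferred from the inequality for nonnegative integrals; square integrability makes
  all three of them finite and equal to the Bochner integrals.\<close>

lemma L2_Cauchy_Schwarz:
  assumes "g \<in> L2 D" "h \<in> L2 D"
  shows "(LINT x|lebesgue_on D. cmod (g x) * cmod (h x)) \<le> L2_norm D g * L2_norm D h"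
proof -
  let ?M = "lebesgue_on D"
  note [measurable] = assms[THEN L2_measurable]
  have int: "integrable ?M (\<lambda>x. (cmod (g x))\<^sup>2)" "integrable ?M (\<lambda>x. (cmod (h x))\<^sup>2)"
    using assms by (auto simp: L2_def)
  have "(\<integral>\<^sup>+x. ennreal (cmod (g x)) * ennreal (cmod (h x)) \<partial>?M)\<^sup>2
      \<le> (\<integral>\<^sup>+x. (ennreal (cmod (g x)))\<^sup>2 \<partial>?M) * (\<integral>\<^sup>+x. (ennreal (cmod (h x)))\<^sup>2 \<partial>?M)"
    by (intro Cauchy_Schwarz_nn_integral) measurable
  then have "(ennreal (LINT x|?M. cmod (g x) * cmod (h x)))\<^sup>2
      \<le> ennreal (LINT x|?M. (cmod (g x))\<^sup>2) * ennreal (LINT x|?M. (cmod (h x))\<^sup>2)"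
    by (simp add: ennreal_mult'[symmetric] ennreal_power int nn_integral_eq_integral
        integrable_cmod_mult[OF assms])
  then have "(LINT x|?M. cmod (g x) * cmod (h x))\<^sup>2 \<le> (L2_norm D g * L2_norm D h)\<^sup>2"
    by (simp add: power_mult_distrib L2_norm_squared ennreal_mult'[symmetric] ennreal_power)
  then show ?thesis
    by (rule power2_le_imp_le) (simp add: L2_norm_nonneg)
qed

lemma L2_diff:
  assumes "g \<in> L2 D" "h \<in> L2 D"
  shows "(\<lambda>x. g x - h x) \<in> L2 D"
proof -
  note [measurable] = assms[THEN L2_measurable]
  have "integrable (lebesgue_on D) (\<lambda>x. (cmod (g x - h x))\<^sup>2)"
  proof (rule Bochner_Integration.integrable_bound)
    show "integrable (lebesgue_on D)
        (\<lambda>x. (cmod (g x))\<^sup>2 + (cmod (h x))\<^sup>2 + 2 * (cmod (g x) * cmod (h x)))"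
      using assms integrable_cmod_mult[OF assms] by (auto simp: L2_def)
    show "AE x in lebesgue_on D. norm ((cmod (g x - h x))\<^sup>2)
        \<le> norm ((cmod (g x))\<^sup>2 + (cmod (h x))\<^sup>2 + 2 * (cmod (g x) * cmod (h x)))"
    proof (rule AE_I2)
      fix x
      have "(cmod (g x - h x))\<^sup>2 \<le> (cmod (g x) + cmod (h x))\<^sup>2"
        by (intro power_mono norm_triangle_ineq4) simp
      then show "norm ((cmod (g x - h x))\<^sup>2)
          \<le> norm ((cmod (g x))\<^sup>2 + (cmod (h x))\<^sup>2 + 2 * (cmod (g x) * cmod (h x)))"
        by (simp add: power2_sum mult.assoc)
    qed
  qed measurable
  then show ?thesis
    by (simp add: L2_def)
qed

text \<open>Expand the square of \<open>h + (g - h)\<close> and apply Cauchy-Schwarz to the cross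
  term. In this form it bounds a moving function by its limit and the error.\<close>

lemma L2_norm_le_add_diff:
  assumes "g \<in> L2 D" "h \<in> L2 D"
  shows "L2_norm D g \<le> L2_norm D h + L2_norm D (\<lambda>x. g x - h x)"
proof (rule power2_le_imp_le)
  let ?M = "lebesgue_on D" and ?d = "\<lambda>x. g x - h x"
  have d: "?d \<in> L2 D"
    by (rule L2_diff[OF assms])
  have "(L2_norm D g)\<^sup>2
      \<le> (LINT x|?M. (cmod (h x))\<^sup>2 + (cmod (?d x))\<^sup>2 + 2 * (cmod (h x) * cmod (?d x)))"
    unfolding L2_norm_squared
  proof (rule integral_mono)
    fix x
    have "(cmod (g x))\<^sup>2 \<le> (cmod (h x) + cmod (?d x))\<^sup>2"
      by (intro power_mono) (use norm_triangle_ineq[of "h x" "?d x"] in simp_all)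
    then show "(cmod (g x))\<^sup>2 \<le> (cmod (h x))\<^sup>2 + (cmod (?d x))\<^sup>2 + 2 * (cmod (h x) * cmod (?d x))"
      by (simp add: power2_sum mult.assoc)
  qed (use assms d integrable_cmod_mult[OF assms(2) d] in \<open>auto simp: L2_def\<close>)
  also have "\<dots> = (L2_norm D h)\<^sup>2 + (L2_norm D ?d)\<^sup>2 + 2 * (LINT x|?M. cmod (h x) * cmod (?d x))"
    using assms d integrable_cmod_mult[OF assms(2) d] by (simp add: L2_def L2_norm_squared)
  also have "\<dots> \<le> (L2_norm D h + L2_norm D ?d)\<^sup>2"
    using L2_Cauchy_Schwarz[OF assms(2) d] by (simp add: power2_sum)
  finally show "(L2_norm D g)\<^sup>2 \<le> (L2_norm D h + L2_norm D ?d)\<^sup>2" .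
qed (simp add: L2_norm_nonneg)

section \<open>Weighted sesquilinear forms and their joint continuity\<close>

definition weighted_form ::
    "(real^'d) set \<Rightarrow> (real^'d \<Rightarrow> real) \<Rightarrow> (real^'d \<Rightarrow> complex) \<Rightarrow> (real^'d \<Rightarrow> complex) \<Rightarrow> complex"
  where "weighted_form D f g h = (LINT x|lebesgue_on D. of_real (f x) * g x * cnj (h x))"

lemma AE_weighted_le:
  fixes g h :: "real^'d \<Rightarrow> complex"
  assumes "f \<in> Linf D"
  shows "AE x in lebesgue_on D. cmod (of_real (f x) * g x * cnj (h x))
      \<le> Linf_norm D f * (cmod (g x) * cmod (h x))"
  using AE_le_Linf_norm[OF assms]
  by eventually_elim (simp add: norm_mult mult.assoc mult_right_mono)

lemma integrable_weighted:
  assumes "f \<in> Linf D" "g \<in> L2 D" "h \<in> L2 D"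
  shows "integrable (lebesgue_on D) (\<lambda>x. of_real (f x) * g x * cnj (h x))"
proof (rule Bochner_Integration.integrable_bound)
  show "integrable (lebesgue_on D) (\<lambda>x. Linf_norm D f * (cmod (g x) * cmod (h x)))"
    using integrable_cmod_mult[OF assms(2,3)] by simp
  note [measurable] = Linf_measurable[OF assms(1)] assms(2,3)[THEN L2_measurable]
  have [measurable]: "cnj \<in> borel_measurable borel"
    by (intro borel_measurable_continuous_onI continuous_intros)
  show "(\<lambda>x. of_real (f x) * g x * cnj (h x)) \<in> borel_measurable (lebesgue_on D)"
    by measurable
  show "AE x in lebesgue_on D. norm (of_real (f x) * g x * cnj (h x))
      \<le> norm (Linf_norm D f * (cmod (g x) * cmod (h x)))"
    using AE_weighted_le[OF assms(1), of g h] by eventually_elim simp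
qed

text \<open>Hoelder's inequality with exponents \<infinity>, 2, 2. The absolute value keeps the
  bound monotone without a separate proof that \<open>Linf_norm\<close> is nonnegative.\<close>

lemma norm_weighted_form_le:
  assumes "f \<in> Linf D" "g \<in> L2 D" "h \<in> L2 D"
  shows "cmod (weighted_form D f g h) \<le> \<bar>Linf_norm D f\<bar> * (L2_norm D g * L2_norm D h)"
proof -
  let ?M = "lebesgue_on D"
  have "cmod (weighted_form D f g h) \<le> (LINT x|?M. cmod (of_real (f x) * g x * cnj (h x)))"
    unfolding weighted_form_def by (rule integral_norm_bound)
  also have "\<dots> \<le> (LINT x|?M. Linf_norm D f * (cmod (g x) * cmod (h x)))"
    using integrable_weighted[OF assms(1-3)] integrable_cmod_mult[OF assms(2,3)]
      AE_weighted_le[OF assms(1), of g h]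
    by (intro integral_mono_AE) auto
  also have "\<dots> = Linf_norm D f * (LINT x|?M. cmod (g x) * cmod (h x))"
    by simp
  also have "\<dots> \<le> \<bar>Linf_norm D f\<bar> * (LINT x|?M. cmod (g x) * cmod (h x))"
    by (intro mult_right_mono) auto
  also have "\<dots> \<le> \<bar>Linf_norm D f\<bar> * (L2_norm D g * L2_norm D h)"
    by (intro mult_left_mono L2_Cauchy_Schwarz assms) auto
  finally show ?thesis .
qed

lemma weighted_form_diff:
  assumes "g \<in> L2 D" "h \<in> L2 D"
  shows "f \<in> Linf D \<Longrightarrow> f' \<in> Linf D \<Longrightarrow>
      weighted_form D (\<lambda>x. f x - f' x) g h = weighted_form D f g h - weighted_form D f' g h"
    and "f \<in> Linf D \<Longrightarrow> g' \<in> L2 D \<Longrightarrow>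
      weighted_form D f (\<lambda>x. g x - g' x) h = weighted_form D f g h - weighted_form D f g' h"
    and "f \<in> Linf D \<Longrightarrow> h' \<in> L2 D \<Longrightarrow>
      weighted_form D f g (\<lambda>x. h x - h' x) = weighted_form D f g h - weighted_form D f g h'"
  using assms
  by (simp_all add: weighted_form_def integrable_weighted left_diff_distrib right_diff_distrib)

text \<open>Telescoping: the weight and the two arguments are replaced by their limits one at a
  time. Each of the three resulting terms has one factor tending to 0, while the others stay
  bounded.\<close>

lemma tendsto_weighted_form:
  fixes g h :: "'a \<Rightarrow> real^'d \<Rightarrow> complex"
  assumes f: "\<forall>\<^sub>F p in F. f p \<in> Linf D" "f0 \<in> Linf D"
      "((\<lambda>p. Linf_norm D (\<lambda>x. f p x - f0 x)) \<longlongrightarrow> 0) F"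
    and g: "\<forall>\<^sub>F p in F. g p \<in> L2 D" "g0 \<in> L2 D" "((\<lambda>p. L2_norm D (\<lambda>x. g p x - g0 x)) \<longlongrightarrow> 0) F"
    and h: "\<forall>\<^sub>F p in F. h p \<in> L2 D" "h0 \<in> L2 D" "((\<lambda>p. L2_norm D (\<lambda>x. h p x - h0 x)) \<longlongrightarrow> 0) F"
  shows "((\<lambda>p. weighted_form D (f p) (g p) (h p)) \<longlongrightarrow> weighted_form D f0 g0 h0) F"
proof -
  define df where "df p = (\<lambda>x. f p x - f0 x)" for p
  define dg where "dg p = (\<lambda>x. g p x - g0 x)" for p
  define dh where "dh p = (\<lambda>x. h p x - h0 x)" for p
  let ?G = "\<lambda>p. L2_norm D g0 + L2_norm D (dg p)" and ?H = "\<lambda>p. L2_norm D h0 + L2_norm D (dh p)"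
  \<comment> \<open>The norms of \<open>g p\<close> and \<open>h p\<close> are replaced by
    \<open>?G p\<close> and \<open>?H p\<close>, so that the bound depends on \<open>p\<close> only
    through the three errors.\<close>
  let ?b = "\<lambda>p. \<bar>Linf_norm D (df p)\<bar> * (?G p * ?H p)
      + \<bar>Linf_norm D f0\<bar> * (L2_norm D (dg p) * ?H p) + \<bar>Linf_norm D f0\<bar> * (L2_norm D g0 * L2_norm D (dh p))"
  have lim: "((\<lambda>p. Linf_norm D (df p)) \<longlongrightarrow> 0) F" "((\<lambda>p. L2_norm D (dg p)) \<longlongrightarrow> 0) F"
    "((\<lambda>p. L2_norm D (dh p)) \<longlongrightarrow> 0) F"
    using f(3) g(3) h(3) by (simp_all add: df_def dg_def dh_def)
  have "\<forall>\<^sub>F p in F. cmod (weighted_form D (f p) (g p) (h p) - weighted_form D f0 g0 h0) \<le> ?b p"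
    using f(1) g(1) h(1)
  proof eventually_elim
    case (elim p)
    have d: "df p \<in> Linf D" "dg p \<in> L2 D" "dh p \<in> L2 D"
      unfolding df_def dg_def dh_def using elim f(2) g(2) h(2) by (auto intro: Linf_diff L2_diff)
    have "L2_norm D (g p) \<le> ?G p" "L2_norm D (h p) \<le> ?H p"
      unfolding dg_def dh_def using elim g(2) h(2) by (auto intro: L2_norm_le_add_diff)
    note GH = this
    have "weighted_form D (f p) (g p) (h p) - weighted_form D f0 g0 h0 =
        weighted_form D (df p) (g p) (h p) + weighted_form D f0 (dg p) (h p) + weighted_form D f0 g0 (dh p)"
      unfolding df_def dg_def dh_def
      using elim f(2) g(2) h(2) by (simp add: weighted_form_diff)
    also have "cmod \<dots> \<le> cmod (weighted_form D (df p) (g p) (h p))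
        + cmod (weighted_form D f0 (dg p) (h p)) + cmod (weighted_form D f0 g0 (dh p))"
      by (intro order_trans[OF norm_triangle_ineq] add_right_mono norm_triangle_ineq)
    also have "\<dots> \<le> \<bar>Linf_norm D (df p)\<bar> * (L2_norm D (g p) * L2_norm D (h p))
      + \<bar>Linf_norm D f0\<bar> * (L2_norm D (dg p) * L2_norm D (h p))
      + \<bar>Linf_norm D f0\<bar> * (L2_norm D g0 * L2_norm D (dh p))"
      by (intro add_mono norm_weighted_form_le f g h d elim)
    also have "\<dots> \<le> ?b p"
      using GH by (intro add_mono mult_left_mono mult_mono order_refl)
        (auto simp: L2_norm_nonneg intro: order_trans[OF L2_norm_nonneg])
    finally show ?case .
  qed
  moreover have "(?b \<longlongrightarrow> \<bar>0\<bar> * ((L2_norm D g0 + 0) * (L2_norm D h0 + 0))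
      + \<bar>Linf_norm D f0\<bar> * (0 * (L2_norm D h0 + 0)) + \<bar>Linf_norm D f0\<bar> * (L2_norm D g0 * 0)) F"
    by (intro tendsto_intros lim)
  then have "(?b \<longlongrightarrow> 0) F"
    by simp
  ultimately have "((\<lambda>p. weighted_form D (f p) (g p) (h p) - weighted_form D f0 g0 h0) \<longlongrightarrow> 0) F"
    by (rule Lim_null_comparison)
  then show ?thesis
    by (simp add: LIM_zero_iff)
qed


text \<open>The weight is real, so conjugating the integrand merely swaps the two arguments.\<close>

lemma cnj_weighted_form: "cnj (weighted_form D f g h) = weighted_form D f h g"
  unfolding weighted_form_def Bochner_Integration.integral_cnj[symmetric]
  by (simp add: mult_ac del: Bochner_Integration.integral_cnj)

section \<open>The Hermitian gradient and mass forms of the transmission problem\<close>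

definition itp_grad_form where
  "itp_grad_form D v w \<phi> \<psi> =
     (LINT x|lebesgue_on D. cdot_cnj (weak_grad D v x) (weak_grad D \<phi> x)
                          - cdot_cnj (weak_grad D w x) (weak_grad D \<psi> x))"

text \<open>The two integrals are kept apart so that each can be treated as a
  \<open>weighted_form\<close>. The difference is indefinite, hence it can vanish on a nonzero
  eigenpair.\<close>

definition itp_mass_form where
  "itp_mass_form D n v w \<phi> \<psi> = weighted_form D (\<lambda>_. 1) v \<phi> - weighted_form D n w \<psi>"

text \<open>Conjugation commutes with the Bochner integral even in the non-integrable case, where
  both sides are 0.\<close>

lemma cnj_itp_grad_form: "cnj (itp_grad_form D v w \<phi> \<psi>) = itp_grad_form D \<phi> \<psi> v w"
  unfolding itp_grad_form_def Bochner_Integration.integral_cnj[symmetric]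
  by (simp add: cdot_cnj_def mult_ac del: Bochner_Integration.integral_cnj)

lemma cnj_itp_mass_form: "cnj (itp_mass_form D n v w \<phi> \<psi>) = itp_mass_form D n \<phi> \<psi> v w"
  by (simp add: itp_mass_form_def cnj_weighted_form)

lemma itp_space_imp_L2:
  assumes "(\<phi>, \<psi>) \<in> itp_space D"
  shows "\<phi> \<in> L2 D" "\<psi> \<in> L2 D"
  using assms by (auto simp: itp_space_def H1_imp_L2)

lemma itp_eigenpair_imp_itp_space: "itp_eigenpair D n \<kappa> v w \<Longrightarrow> (v, w) \<in> itp_space D"
  by (auto simp: itp_eigenpair_def itp_space_nz_def)

text \<open>The integral on the right of the weak equation splits because an essentially bounded
  weight times two L2 functions is integrable.\<close>

lemma itp_eigenpair_form_eq:
  assumes "itp_eigenpair D n \<kappa> v w" "n \<in> Linf D" "(\<phi>, \<psi>) \<in> itp_space D"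
  shows "itp_grad_form D v w \<phi> \<psi> = \<kappa>\<^sup>2 * itp_mass_form D n v w \<phi> \<psi>"
proof -
  note L2 = itp_space_imp_L2[OF itp_eigenpair_imp_itp_space[OF assms(1)]] itp_space_imp_L2[OF assms(3)]
  have "(LINT x|lebesgue_on D. v x * cnj (\<phi> x) - of_real (n x) * w x * cnj (\<psi> x))
      = itp_mass_form D n v w \<phi> \<psi>"
    unfolding itp_mass_form_def weighted_form_def
    using integrable_weighted[OF Linf_const[of 1 D] L2(1,3)] integrable_weighted[OF assms(2) L2(2,4)]
    by simp
  then show ?thesis
    using assms(1,3) by (auto simp: itp_eigenpair_def itp_grad_form_def)
qed

text \<open>Otherwise \<open>\<kappa>\<^sup>2\<close> would be a quotient of diagonal values of two
  Hermitian forms, hence real.\<close>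

lemma itp_mass_form_eq_0:
  assumes "itp_eigenpair D n \<kappa> v w" "n \<in> Linf D" "\<kappa>\<^sup>2 \<notin> \<real>"
  shows "itp_mass_form D n v w v w = 0"
proof (rule ccontr)
  assume nz: "itp_mass_form D n v w v w \<noteq> 0"
  have "\<kappa>\<^sup>2 = itp_grad_form D v w v w / itp_mass_form D n v w v w"
    using itp_eigenpair_form_eq[OF assms(1,2) itp_eigenpair_imp_itp_space[OF assms(1)]] nz by simp
  also have "\<dots> \<in> \<real>"
    by (intro Reals_divide) (simp_all add: Reals_cnj_iff cnj_itp_grad_form cnj_itp_mass_form)
  finally show False
    using assms(3) by simp
qed

section \<open>Limits along curves and difference quotients\<close>

lemma curve_C1_on_imp_has_derivative:
  "curve_C1_on X N S f f' \<Longrightarrow> p \<in> S \<Longrightarrow> curve_has_derivative X N f (f' p) p"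
  by (simp add: curve_C1_on_def)

lemma curve_continuous_on_imp_L2_tendsto:
  assumes "curve_continuous_on (H1_norm D) S u" "p \<in> S" "open S"
  shows "((\<lambda>q. L2_norm D (\<lambda>x. u q x - u p x)) \<longlongrightarrow> 0) (at p)"
proof (rule Lim_null_comparison)
  show "((\<lambda>q. H1_norm D (\<lambda>x. u q x - u p x)) \<longlongrightarrow> 0) (at p)"
    using bspec[OF assms(1)[unfolded curve_continuous_on_def] assms(2)]
    by (simp only: at_within_open[OF assms(2,3)])
qed (simp add: L2_norm_nonneg L2_norm_le_H1_norm)

lemma vector_derivative_quotient_tendsto:
  assumes "(f has_vector_derivative f') (at (p::real))"
  shows "((\<lambda>q. (f q - f p) /\<^sub>R (q - p)) \<longlongrightarrow> f') (at p)"
proof -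
  have "((\<lambda>q. norm ((f q - f p) /\<^sub>R (q - p) - f')) \<longlongrightarrow> 0) (at p)"
  proof (rule Lim_transform_eventually)
    show "((\<lambda>q. norm ((f q - f p) - (q - p) *\<^sub>R f') / norm (q - p)) \<longlongrightarrow> 0) (at p)"
      using assms by (simp add: has_vector_derivative_def has_derivative_iff_norm)
    show "\<forall>\<^sub>F q in at p. norm ((f q - f p) - (q - p) *\<^sub>R f') / norm (q - p)
        = norm ((f q - f p) /\<^sub>R (q - p) - f')"
    proof (rule eventually_at_filter[THEN iffD2, OF always_eventually], intro allI impI)
      fix q assume "q \<noteq> p"
      then have "(f q - f p) /\<^sub>R (q - p) - f' = ((f q - f p) - (q - p) *\<^sub>R f') /\<^sub>R (q - p)"
        by (simp add: scaleR_diff_right)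
      then show "norm ((f q - f p) - (q - p) *\<^sub>R f') / norm (q - p) = norm ((f q - f p) /\<^sub>R (q - p) - f')"
        by (simp add: divide_inverse_commute)
    qed
  qed
  then show ?thesis
    using Lim_null tendsto_norm_zero_iff by blast
qed

text \<open>Isolates the factor \<open>q - p\<close>, so that a change of refractive index is
  governed by the difference quotient, whose limit is the derivative of the index.\<close>

lemma weighted_form_difference_quotient:
  assumes "f \<in> Linf D" "f0 \<in> Linf D" "g \<in> L2 D" "h \<in> L2 D" "q \<noteq> p"
  shows "weighted_form D f g h - weighted_form D f0 g h
      = of_real (q - p) * weighted_form D (\<lambda>x. (f x - f0 x) /\<^sub>R (q - p)) g h"
proof -
  have "weighted_form D f g h - weighted_form D f0 g h = weighted_form D (\<lambda>x. f x - f0 x) g h"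
    using assms by (simp add: weighted_form_diff)
  also have "\<dots> = (LINT x|lebesgue_on D.
      of_real (q - p) * (of_real ((f x - f0 x) /\<^sub>R (q - p)) * g x * cnj (h x)))"
    unfolding weighted_form_def
    using assms(5)
    by (intro Bochner_Integration.integral_cong)
      (simp_all add: mult.assoc[symmetric] flip: of_real_mult of_real_diff)
  finally show ?thesis
    unfolding weighted_form_def by (simp only: integral_mult_right_zero)
qed

section \<open>Loss of differentiability where a non-real eigenvalue becomes real\<close>

theorem theorem2:
  fixes D :: "(real^'d) set" and p\<^sub>0 \<epsilon> :: real
    and n n' :: "real \<Rightarrow> real^'d \<Rightarrow> real"
    and \<kappa> :: "real \<Rightarrow> complex" and v w :: "real \<Rightarrow> real^'d \<Rightarrow> complex"
  defines "I \<equiv> {p\<^sub>0 - \<epsilon><..<p\<^sub>0 + \<epsilon>}"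
  assumes "CARD('d) \<in> {1, 2, 3}"
    and "bounded_lipschitz_domain D"
    and "\<epsilon> > 0"
    and "\<And>p. p \<in> I \<Longrightarrow> n p \<in> refractive_indices D"
    and "curve_C1_on (Linf D) (Linf_norm D) I n n'"
    and "eigenpair_trajectory D I n \<kappa> v w"
    and "trajectory_continuous_on D I \<kappa> v w"
    and "trajectory_C1_on D (I - {p\<^sub>0}) \<kappa> v w"
    and "(LINT x|lebesgue_on D. n' p\<^sub>0 x * (cmod (w p\<^sub>0 x))\<^sup>2) \<noteq> 0"
    and "(\<forall>p\<in>{p\<^sub>0 - \<epsilon><..<p\<^sub>0}. \<kappa> p \<notin> \<real>) \<or> (\<forall>p\<in>{p\<^sub>0<..<p\<^sub>0 + \<epsilon>}. \<kappa> p \<notin> \<real>)"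
    and "\<kappa> p\<^sub>0 \<in> \<real> - {0}"
  shows "exceptional_point D I \<kappa> v w p\<^sub>0 \<and> \<not> trajectory_differentiable_at D p\<^sub>0 \<kappa> v w"
proof -
  let ?n0 = "n p\<^sub>0" and ?v0 = "v p\<^sub>0" and ?w0 = "w p\<^sub>0" and ?\<kappa>0 = "\<kappa> p\<^sub>0"
  let ?Q = "\<lambda>p x. (n p x - ?n0 x) /\<^sub>R (p - p\<^sub>0)"
  have I: "open I" "p\<^sub>0 \<in> I"
    using \<open>\<epsilon> > 0\<close> by (auto simp: I_def)
  have n: "n p \<in> Linf D" if "p \<in> I" for p
    using assms(5)[OF that] by (simp add: refractive_indices_def)
  have pair: "itp_eigenpair D (n p) (\<kappa> p) (v p) (w p)" if "p \<in> I" for p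
    using assms(7) that by (simp add: eigenpair_trajectory_def)
  note space = itp_eigenpair_imp_itp_space[OF pair]
  note L2 = itp_space_imp_L2[OF space]
  have near: "\<forall>\<^sub>F p in at p\<^sub>0. p \<in> I \<and> p \<noteq> p\<^sub>0"
    using eventually_at_in_open[OF I] by simp
  have Q: "\<forall>\<^sub>F p in at p\<^sub>0. ?Q p \<in> Linf D"
    using near
  proof eventually_elim
    case (elim p)
    show ?case
      by (rule Linf_scaleR, rule Linf_diff) (use elim n I in blast)+
  qed
  have dn: "n' p\<^sub>0 \<in> Linf D" "((\<lambda>p. Linf_norm D (\<lambda>x. ?Q p x - n' p\<^sub>0 x)) \<longlongrightarrow> 0) (at p\<^sub>0)"
    using curve_C1_on_imp_has_derivative[OF assms(6) I(2)] unfolding curve_has_derivative_def by blast+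
  have cont: "(\<kappa> \<longlongrightarrow> ?\<kappa>0) (at p\<^sub>0)"
    "((\<lambda>p. L2_norm D (\<lambda>x. v p x - ?v0 x)) \<longlongrightarrow> 0) (at p\<^sub>0)"
    "((\<lambda>p. L2_norm D (\<lambda>x. w p x - ?w0 x)) \<longlongrightarrow> 0) (at p\<^sub>0)"
  proof -
    have traj: "continuous_on I \<kappa>" "curve_continuous_on (H1_norm D) I v" "curve_continuous_on (H1_norm D) I w"
      using assms(8) unfolding trajectory_continuous_on_def by blast+
    then show "(\<kappa> \<longlongrightarrow> ?\<kappa>0) (at p\<^sub>0)"
      using I unfolding continuous_on_def by (metis at_within_open)
    show "((\<lambda>p. L2_norm D (\<lambda>x. v p x - ?v0 x)) \<longlongrightarrow> 0) (at p\<^sub>0)"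
      by (rule curve_continuous_on_imp_L2_tendsto[OF traj(2) I(2,1)])
    show "((\<lambda>p. L2_norm D (\<lambda>x. w p x - ?w0 x)) \<longlongrightarrow> 0) (at p\<^sub>0)"
      by (rule curve_continuous_on_imp_L2_tendsto[OF traj(3) I(2,1)])
  qed
  have ev_L2: "\<forall>\<^sub>F p in at p\<^sub>0. v p \<in> L2 D" "\<forall>\<^sub>F p in at p\<^sub>0. w p \<in> L2 D"
    using near by (eventually_elim, simp add: L2)+

  \<comment> \<open>The test pair is left general for two uses: the trajectory itself, which makes
    the mass form vanish at \<open>p\<^sub>0\<close>, and the fixed pair at
    \<open>p\<^sub>0\<close>, which enters the difference quotient.\<close>
  have mass_lim: "((\<lambda>p. itp_mass_form D (n p) (v p) (w p) (\<phi> p) (\<psi> p))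
      \<longlongrightarrow> itp_mass_form D ?n0 ?v0 ?w0 ?v0 ?w0) (at p\<^sub>0)"
    if \<phi>: "\<forall>\<^sub>F p in at p\<^sub>0. \<phi> p \<in> L2 D" "((\<lambda>p. L2_norm D (\<lambda>x. \<phi> p x - ?v0 x)) \<longlongrightarrow> 0) (at p\<^sub>0)"
      and \<psi>: "\<forall>\<^sub>F p in at p\<^sub>0. \<psi> p \<in> L2 D" "((\<lambda>p. L2_norm D (\<lambda>x. \<psi> p x - ?w0 x)) \<longlongrightarrow> 0) (at p\<^sub>0)"
    for \<phi> \<psi> :: "real \<Rightarrow> real^'d \<Rightarrow> complex"
  proof (rule Lim_transform_eventually)
    have const: "((\<lambda>p. weighted_form D f (g p) (h p)) \<longlongrightarrow> weighted_form D f g0 h0) (at p\<^sub>0)"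
      if "f \<in> Linf D" "\<forall>\<^sub>F p in at p\<^sub>0. g p \<in> L2 D" "g0 \<in> L2 D"
        "((\<lambda>p. L2_norm D (\<lambda>x. g p x - g0 x)) \<longlongrightarrow> 0) (at p\<^sub>0)"
        "\<forall>\<^sub>F p in at p\<^sub>0. h p \<in> L2 D" "h0 \<in> L2 D"
        "((\<lambda>p. L2_norm D (\<lambda>x. h p x - h0 x)) \<longlongrightarrow> 0) (at p\<^sub>0)"
      for f g g0 h h0
      using that by (intro tendsto_weighted_form) (auto simp: Linf_norm_zero)
    \<comment> \<open>Here \<open>n p\<close> is written as
      \<open>?n0 + (p - p\<^sub>0) ?Q p\<close>, so differentiability of the index supplies its
      continuity: the \<open>?Q\<close> term has a finite limit and the factor
      \<open>p - p\<^sub>0\<close> removes it.\<close>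
    show "((\<lambda>p. weighted_form D (\<lambda>_. 1) (v p) (\<phi> p) - (weighted_form D ?n0 (w p) (\<psi> p)
          + of_real (p - p\<^sub>0) * weighted_form D (?Q p) (w p) (\<psi> p)))
        \<longlongrightarrow> itp_mass_form D ?n0 ?v0 ?w0 ?v0 ?w0) (at p\<^sub>0)"
    proof -
      have "((\<lambda>p. weighted_form D (\<lambda>_. 1) (v p) (\<phi> p) - (weighted_form D ?n0 (w p) (\<psi> p)
          + of_real (p - p\<^sub>0) * weighted_form D (?Q p) (w p) (\<psi> p)))
        \<longlongrightarrow> weighted_form D (\<lambda>_. 1) ?v0 ?v0 - (weighted_form D ?n0 ?w0 ?w0
          + of_real (p\<^sub>0 - p\<^sub>0) * weighted_form D (n' p\<^sub>0) ?w0 ?w0)) (at p\<^sub>0)"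
        by (intro tendsto_intros const tendsto_weighted_form Linf_const n L2 I cont ev_L2 Q dn \<phi> \<psi>)
      then show ?thesis
        by (simp add: itp_mass_form_def)
    qed
    show "\<forall>\<^sub>F p in at p\<^sub>0. weighted_form D (\<lambda>_. 1) (v p) (\<phi> p) - (weighted_form D ?n0 (w p) (\<psi> p)
          + of_real (p - p\<^sub>0) * weighted_form D (?Q p) (w p) (\<psi> p))
        = itp_mass_form D (n p) (v p) (w p) (\<phi> p) (\<psi> p)"
      using near \<phi>(1) \<psi>(1)
    proof eventually_elim
      case (elim p)
      then have p: "p \<in> I" "p \<noteq> p\<^sub>0"
        by blast+
      show ?case
        unfolding itp_mass_form_def
        using weighted_form_difference_quotient[OF n[OF p(1)] n[OF I(2)] L2(2)[OF p(1)] elim(3) p(2)]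
        by (metis add.commute diff_add_cancel)
    qed
  qed

  \<comment> \<open>The filter \<open>F\<close> is the left or right neighbourhood filter of
    \<open>p\<^sub>0\<close>, whichever side carries non-real eigenvalues; the two cases are treated
    together from here on.\<close>
  obtain F where F: "F \<noteq> bot" "F \<le> at p\<^sub>0" "\<forall>\<^sub>F p in F. \<kappa> p \<notin> \<real>"
    using assms(11)
  proof
    assume *: "\<forall>p\<in>{p\<^sub>0 - \<epsilon><..<p\<^sub>0}. \<kappa> p \<notin> \<real>"
    have "\<forall>\<^sub>F p in at_left p\<^sub>0. p \<in> {p\<^sub>0 - \<epsilon><..<p\<^sub>0}"
      using \<open>\<epsilon> > 0\<close> by (intro eventually_at_left_real) simp
    then have "\<forall>\<^sub>F p in at_left p\<^sub>0. \<kappa> p \<notin> \<real>"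
      by eventually_elim (use * in blast)
    then show ?thesis
      by (intro that[of "at_left p\<^sub>0"] at_le) simp_all
  next
    assume *: "\<forall>p\<in>{p\<^sub>0<..<p\<^sub>0 + \<epsilon>}. \<kappa> p \<notin> \<real>"
    have "\<forall>\<^sub>F p in at_right p\<^sub>0. p \<in> {p\<^sub>0<..<p\<^sub>0 + \<epsilon>}"
      using \<open>\<epsilon> > 0\<close> by (intro eventually_at_right_real) simp
    then have "\<forall>\<^sub>F p in at_right p\<^sub>0. \<kappa> p \<notin> \<real>"
      by eventually_elim (use * in blast)
    then show ?thesis
      by (intro that[of "at_right p\<^sub>0"] at_le) simp_all
  qed

  have \<kappa>0: "cnj ?\<kappa>0 = ?\<kappa>0" "?\<kappa>0 \<noteq> 0" "Re ?\<kappa>0 \<noteq> 0"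
    using assms(12) by (auto simp: Reals_cnj_iff complex_eq_iff complex_is_Real_iff)
  \<comment> \<open>A non-real \<open>\<kappa> p\<close> could be purely imaginary and have a real
    square. Continuity excludes this near \<open>p\<^sub>0\<close>, where the eigenvalue is real and
    nonzero.\<close>
  have "\<forall>\<^sub>F p in at p\<^sub>0. Re (\<kappa> p) \<noteq> 0"
    using tendsto_imp_eventually_ne[OF tendsto_Re[OF cont(1)] \<kappa>0(3)] .
  then have "\<forall>\<^sub>F p in F. Re (\<kappa> p) \<noteq> 0"
    using F(2) by (rule filter_leD[rotated])
  moreover have "\<forall>\<^sub>F p in F. p \<in> I"
    using filter_leD[OF F(2) near] by eventually_elim simp
  ultimately have "\<forall>\<^sub>F p in F. itp_mass_form D (n p) (v p) (w p) (v p) (w p) = 0"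
    using F(3)
  proof eventually_elim
    case (elim p)
    then have "(\<kappa> p)\<^sup>2 \<notin> \<real>"
      by (simp add: complex_is_Real_iff power2_eq_square)
    then show ?case
      using itp_mass_form_eq_0[OF pair n] elim(2) by simp
  qed
  then have "((\<lambda>p. itp_mass_form D (n p) (v p) (w p) (v p) (w p)) \<longlongrightarrow> 0) F"
    by (rule tendsto_eventually)
  moreover have "((\<lambda>p. itp_mass_form D (n p) (v p) (w p) (v p) (w p))
      \<longlongrightarrow> itp_mass_form D ?n0 ?v0 ?w0 ?v0 ?w0) F"
    by (rule tendsto_mono[OF F(2)], rule mass_lim) (intro ev_L2 cont)+
  ultimately have mass0: "itp_mass_form D ?n0 ?v0 ?w0 ?v0 ?w0 = 0"
    using tendsto_unique[OF F(1)] by blast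

  \<comment> \<open>Both claims reduce to the eigenvalue component: differentiability of the
    trajectory and its C1 property near \<open>p\<^sub>0\<close> each contain that of
    \<open>\<kappa>\<close> at \<open>p\<^sub>0\<close>.\<close>
  have not_diff: "\<not> \<kappa> differentiable (at p\<^sub>0)"
  proof
    assume "\<kappa> differentiable (at p\<^sub>0)"
    then obtain k where "(\<kappa> has_vector_derivative k) (at p\<^sub>0)"
      by (auto simp: vector_derivative_works)
    then have quot: "((\<lambda>p. (\<kappa> p - ?\<kappa>0) /\<^sub>R (p - p\<^sub>0)) \<longlongrightarrow> k) (at p\<^sub>0)"
      by (rule vector_derivative_quotient_tendsto)
    let ?B = "\<lambda>p. itp_mass_form D (n p) (v p) (w p) ?v0 ?w0"
    have eq: "\<forall>\<^sub>F p in at p\<^sub>0. ((\<kappa> p - ?\<kappa>0) /\<^sub>R (p - p\<^sub>0)) * (\<kappa> p + ?\<kappa>0) * ?B p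
        = ?\<kappa>0\<^sup>2 * weighted_form D (?Q p) (w p) ?w0"
      using near
    proof eventually_elim
      case (elim p)
      then have p: "p \<in> I" "p \<noteq> p\<^sub>0"
        by auto
      have "(\<kappa> p)\<^sup>2 * ?B p = itp_grad_form D (v p) (w p) ?v0 ?w0"
        using itp_eigenpair_form_eq[OF pair[OF p(1)] n[OF p(1)] space[OF I(2)]] by simp
      \<comment> \<open>Hermitian symmetry exchanges the roles of trial and test pair, so the
        equation at \<open>p\<^sub>0\<close> applies. Conjugating back leaves
        \<open>?\<kappa>0\<^sup>2\<close> unchanged because \<open>?\<kappa>0\<close> is
        real.\<close>
      also have "\<dots> = cnj (itp_grad_form D ?v0 ?w0 (v p) (w p))"
        by (simp add: cnj_itp_grad_form)
      also have "\<dots> = ?\<kappa>0\<^sup>2 * itp_mass_form D ?n0 (v p) (w p) ?v0 ?w0"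
        using itp_eigenpair_form_eq[OF pair[OF I(2)] n[OF I(2)] space[OF p(1)]] \<kappa>0(1)
        by (simp add: cnj_itp_mass_form)
      \<comment> \<open>The mass form subtracts its index term, so passing from \<open>n p\<close>
        to \<open>?n0\<close> adds the contribution of \<open>n p - ?n0\<close>.\<close>
      also have "itp_mass_form D ?n0 (v p) (w p) ?v0 ?w0
          = ?B p + of_real (p - p\<^sub>0) * weighted_form D (?Q p) (w p) ?w0"
        using weighted_form_difference_quotient[OF n[OF p(1)] n[OF I(2)] L2(2)[OF p(1)] L2(2)[OF I(2)] p(2)]
        by (simp add: itp_mass_form_def algebra_simps)
      finally have "((\<kappa> p)\<^sup>2 - ?\<kappa>0\<^sup>2) * ?B p = of_real (p - p\<^sub>0) * (?\<kappa>0\<^sup>2 * weighted_form D (?Q p) (w p) ?w0)"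
        by (simp add: algebra_simps)
      then show ?case
        using p(2) by (simp add: scaleR_conv_of_real power2_eq_square field_simps)
    qed
    \<comment> \<open>Differentiability keeps the quotient convergent to \<open>k\<close>, so the
      vanishing limit of \<open>?B\<close> from \<open>mass0\<close> forces the whole product to 0,
      whatever \<open>k\<close> is.\<close>
    have lim1: "((\<lambda>p. ((\<kappa> p - ?\<kappa>0) /\<^sub>R (p - p\<^sub>0)) * (\<kappa> p + ?\<kappa>0) * ?B p)
        \<longlongrightarrow> k * (?\<kappa>0 + ?\<kappa>0) * 0) (at p\<^sub>0)"
      using mass_lim[of "\<lambda>_. ?v0" "\<lambda>_. ?w0"] L2[OF I(2)]
      by (intro tendsto_intros quot cont) (simp add: mass0 L2_norm_def)
    have lim2: "((\<lambda>p. ?\<kappa>0\<^sup>2 * weighted_form D (?Q p) (w p) ?w0)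
        \<longlongrightarrow> ?\<kappa>0\<^sup>2 * weighted_form D (n' p\<^sub>0) ?w0 ?w0) (at p\<^sub>0)"
      using L2[OF I(2)]
      by (intro tendsto_intros tendsto_weighted_form Q dn ev_L2 cont) (simp_all add: L2_norm_def)
    have "?\<kappa>0\<^sup>2 * weighted_form D (n' p\<^sub>0) ?w0 ?w0 = k * (?\<kappa>0 + ?\<kappa>0) * 0"
      by (rule tendsto_unique[OF trivial_limit_at lim2 Lim_transform_eventually[OF lim1 eq]])
    \<comment> \<open>On the diagonal the form is the real integral assumed to be nonzero, which
      contradicts the limit just found.\<close>
    moreover have "weighted_form D (n' p\<^sub>0) ?w0 ?w0
        = of_real (LINT x|lebesgue_on D. n' p\<^sub>0 x * (cmod (?w0 x))\<^sup>2)"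
      unfolding weighted_form_def integral_complex_of_real[symmetric]
      by (simp add: mult.assoc complex_norm_square[symmetric])
    ultimately show False
      using assms(10) \<kappa>0(2) by simp
  qed
  show ?thesis
  proof
    show "exceptional_point D I \<kappa> v w p\<^sub>0"
      unfolding exceptional_point_def
    proof (intro conjI notI I)
      assume "\<exists>\<delta>>0. {p\<^sub>0 - \<delta><..<p\<^sub>0 + \<delta>} \<subseteq> I \<and> trajectory_C1_on D {p\<^sub>0 - \<delta><..<p\<^sub>0 + \<delta>} \<kappa> v w"
      then obtain \<delta> where "\<delta> > 0" "\<kappa> C1_differentiable_on {p\<^sub>0 - \<delta><..<p\<^sub>0 + \<delta>}"
        by (auto simp: trajectory_C1_on_def)
      then have "\<kappa> differentiable (at p\<^sub>0)"
        by (simp add: C1_differentiable_on_eq)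
      then show False
        using not_diff by simp
    qed
    show "\<not> trajectory_differentiable_at D p\<^sub>0 \<kappa> v w"
      using not_diff by (simp add: trajectory_differentiable_at_def)
  qed
qed

end
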